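(* Let $N\colon\mathbb{B}^L\to\mathbb{B}^L$ be the reduced Boolean Delta-Notch system over a graph $\mathcal{G}$ as in the context. Let $x\in\mathbb{B}^L$ and let $(I_\nu)_\nu$ be the partition of $\{i\in C: x_i=0\}$ into maximal disjoint subsets $I_\nu$ such that the induced subgraph $\mathcal{G}_{I_\nu}$ is connected (i.e. the vertex sets of the connected components of the subgraph of $\mathcal{G}$ induced by $\{i: x_i=0\}$). Then a fixed point $y\in\mathbb{B}^L$ of $N$ is reachable from $x$ in $AD_N$ if and only if for every $\nu$ there exists $i\in I_\nu$ with $y_i=0$.
   Context: Let $L\ge 1$ and let $\mathcal{G}$ be an undirected connected graph without loops on the vertex set $C=\{1,\dots,L\}$. For $i\in C$ let $S(i)$ be the set of neighbours of $i$ in $\mathcal{G}$. For $I\subseteq C$, $\mathcal{G}_I$ is the subgraph with vertex set $I$ and all edges of $\mathcal{G}$ having both endpoints in $I$. $\mathbb{B}=\{0,1\}$. The reduced Boolean Delta-Notch system is $N\colon\mathbb{B}^L\to\mathbb{B}^L$, $N_i(n)=\bigvee_{j\in S(i)}(1-n_j)$ (empty disjunction $=0$). The asynchronous dynamics $AD_N$ is the directed graph on $\mathbb{B}^L$ with an edge from $x$ to the state obtained by flipping coordinate $i$ whenever $N_i(x)\neq x_i$. A state $y$ is reachable from $x$ if there is a directed path (possibly of length zero) from $x$ to $y$. A fixed point is $y$ with $N(y)=y$. *)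

theory Defs
  imports "Graph_Theory.Graph_Theory" "HOL-Library.FuncSet"
begin

text \<open>The Boolean value 0 is False and 1 is True, so a coordinate \<open>1 - n\<^sub>j\<close> is a negation.
  States are extensional (undefined outside \<open>{1..L}\<close>), so that equality of functions is
  equality of states.\<close>

definition states :: "nat \<Rightarrow> (nat \<Rightarrow> bool) set" where
  "states L = {1..L} \<rightarrow>\<^sub>E UNIV"

text \<open>Undirected loop-free graphs are symmetric irreflexive digraphs (locale \<open>pair_graph\<close>).\<close>

definition neighbours :: "nat pair_pre_digraph \<Rightarrow> nat \<Rightarrow> nat set" where
  "neighbours G i = {j. i \<rightarrow>\<^bsub>G\<^esub> j}"

definition delta_notch :: "nat pair_pre_digraph \<Rightarrow> (nat \<Rightarrow> bool) \<Rightarrow> (nat \<Rightarrow> bool)" where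
  "delta_notch G n = (\<lambda>i\<in>pverts G. \<exists>j\<in>neighbours G i. \<not> n j)"

definition async_dynamics ::
  "nat \<Rightarrow> ((nat \<Rightarrow> bool) \<Rightarrow> (nat \<Rightarrow> bool)) \<Rightarrow> (nat \<Rightarrow> bool) pair_pre_digraph" where
  "async_dynamics L F =
     \<lparr> pverts = states L,
       parcs = {(x, x(i := \<not> x i)) | x i. x \<in> states L \<and> i \<in> {1..L} \<and> F x i \<noteq> x i} \<rparr>"

text \<open>The predicate \<open>Digraph_Component.connected\<close> is false for the graph without vertices, so
  components are nonempty.\<close>

definition component_vertex_sets :: "nat pair_pre_digraph \<Rightarrow> nat set \<Rightarrow> nat set set" where
  "component_vertex_sets G Z =
     {I. I \<subseteq> Z \<and> Digraph_Component.connected (G \<restriction> I) \<and>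
         (\<forall>J. I \<subseteq> J \<and> J \<subseteq> Z \<and> Digraph_Component.connected (G \<restriction> J) \<longrightarrow> J = I)}"

end

theory Submission
  imports Defs
begin

text \<open>
  Call \<open>K \<subseteq> Z\<close> closed in \<open>Z\<close> if no edge leads from \<open>K\<close> to \<open>Z - K\<close>. The components of \<open>Z\<close> are
  the minimal nonempty closed subsets of \<open>Z\<close>, so the condition on \<open>y\<close> says that each nonempty
  closed set of zeros of \<open>x\<close> contains a zero of \<open>y\<close>.

  Necessity: an asynchronous step turns a nonempty closed set \<open>K\<close> of zeros into another one
  inside \<open>K\<close>. If a vertex of \<open>K\<close> is raised, it has a zero neighbour, which remains in \<open>K\<close>; a
  vertex is only lowered when all its neighbours are 1, so it is not adjacent to \<open>K\<close>.

  Sufficiency: growing the set of common zeros of \<open>x\<close> and \<open>y\<close> inside the zeros of \<open>x\<close>, one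
  adjacent vertex at a time, can only end at the set of all zeros of \<open>x\<close>. Reversing
  this, all other zeros of \<open>x\<close> can be raised. Then the missing zeros of \<open>y\<close> can be
  lowered in any order, because they are pairwise non-adjacent.
\<close>

definition closed_in :: "nat pair_pre_digraph \<Rightarrow> nat set \<Rightarrow> nat set \<Rightarrow> bool" where
  "closed_in G Z K \<longleftrightarrow> K \<subseteq> Z \<and> (\<forall>u\<in>K. neighbours G u \<inter> Z \<subseteq> K)"

definition zeros :: "nat \<Rightarrow> (nat \<Rightarrow> bool) \<Rightarrow> nat set" where
  "zeros L x = {i \<in> {1..L}. \<not> x i}"

text \<open>The inverse of \<open>zeros L\<close> between \<open>states L\<close> and subsets of
  \<open>{1..L}\<close>. It lets paths be built on sets of zeros, where raising a vertex removes it
  and lowering inserts it.\<close>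

definition state_of_zeros :: "nat \<Rightarrow> nat set \<Rightarrow> (nat \<Rightarrow> bool)" where
  "state_of_zeros L S = (\<lambda>i\<in>{1..L}. i \<notin> S)"

lemma closed_in_trans: "closed_in G Z K \<Longrightarrow> closed_in G K K' \<Longrightarrow> closed_in G Z K'"
  unfolding closed_in_def by blast

lemma closed_in_restrict: "closed_in G Z K \<Longrightarrow> K \<subseteq> J \<Longrightarrow> J \<subseteq> Z \<Longrightarrow> closed_in G J K"
  unfolding closed_in_def by blast

lemma finite_zeros: "finite (zeros L x)"
  by (simp add: zeros_def)

lemma state_of_zeros_in_states: "state_of_zeros L S \<in> states L"
  by (simp add: state_of_zeros_def states_def)

lemma zeros_state_of_zeros: "S \<subseteq> {1..L} \<Longrightarrow> zeros L (state_of_zeros L S) = S"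
  by (auto simp: zeros_def state_of_zeros_def)

lemma state_of_zeros_zeros: "x \<in> states L \<Longrightarrow> state_of_zeros L (zeros L x) = x"
  unfolding states_def by (rule ext) (auto simp: zeros_def state_of_zeros_def dest: PiE_arb)

lemma wf_async_dynamics: "wf_digraph (async_dynamics L F)"
  by unfold_locales (auto simp: async_dynamics_def states_def PiE_iff extensional_def)

section \<open>Components as minimal closed sets\<close>

locale delta_notch_graph = pair_graph G for G :: "nat pair_pre_digraph" +
  fixes L :: nat
  assumes verts: "pverts G = {1..L}"
begin

lemma neighbours_sym: "v \<in> neighbours G u \<longleftrightarrow> u \<in> neighbours G v"
  by (auto simp: neighbours_def intro: arcs_symmetric)

lemma not_in_neighbours_self: "u \<notin> neighbours G u"
  using pair_no_loops[of "(u, u)"] by (auto simp: neighbours_def)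

text \<open>A closed subset that contains \<open>u\<close> contains everything reachable from
  \<open>u\<close> within \<open>I\<close>; conversely, the vertices reachable from \<open>u\<close>
  form a nonempty closed set.\<close>

lemma connected_induce_iff:
  "Digraph_Component.connected (G \<restriction> I) \<longleftrightarrow> I \<noteq> {} \<and> (\<forall>K. closed_in G I K \<and> K \<noteq> {} \<longrightarrow> K = I)"
proof -
  let ?R = "{(u, v). u \<in> I \<and> v \<in> I \<and> v \<in> neighbours G u}"
  \<comment> \<open>Connectedness is defined through the symmetric closure, which adds no arcs to a
    symmetric graph.\<close>
  have arcs: "parcs (mk_symmetric (G \<restriction> I)) = ?R"
    by (auto simp: parcs_mk_symmetric neighbours_def intro: arcs_symmetric)
  have conn: "Digraph_Component.connected (G \<restriction> I) \<longleftrightarrow>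
      I \<noteq> {} \<and> (\<forall>u\<in>I. \<forall>v\<in>I. (u, v) \<in> rtrancl_on I ?R)"
    by (simp add: Digraph_Component.connected_def strongly_connected_def reachable_def arcs)
  show ?thesis
  proof (intro iffI conjI allI impI)
    assume "Digraph_Component.connected (G \<restriction> I)"
    then show "I \<noteq> {}" by (simp add: conn)
  next
    fix K
    assume c: "Digraph_Component.connected (G \<restriction> I)" and K: "closed_in G I K \<and> K \<noteq> {}"
    then obtain u where u: "u \<in> K" "u \<in> I" by (auto simp: closed_in_def)
    have "v \<in> K" if "v \<in> I" for v
    proof -
      have "(u, v) \<in> rtrancl_on I ?R" using c u that by (simp add: conn)
      then show ?thesis
        by (induction rule: rtrancl_on_induct) (use K u in \<open>auto simp: closed_in_def\<close>)
    qed
    then show "K = I" using K by (auto simp: closed_in_def)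
  next
    assume min: "I \<noteq> {} \<and> (\<forall>K. closed_in G I K \<and> K \<noteq> {} \<longrightarrow> K = I)"
    have "(u, v) \<in> rtrancl_on I ?R" if "u \<in> I" "v \<in> I" for u v
    proof -
      let ?K = "{w. (u, w) \<in> rtrancl_on I ?R}"
      have "closed_in G I ?K"
        by (auto simp: closed_in_def dest: in_rtrancl_on_in_F intro: rtrancl_on_into_rtrancl_on)
      moreover have "u \<in> ?K" using that by simp
      ultimately have "?K = I" using min by blast
      then show ?thesis using that by blast
    qed
    then show "Digraph_Component.connected (G \<restriction> I)" using min by (simp add: conn)
  qed
qed

text \<open>If a vertex \<open>j\<close> of \<open>Z\<close> is adjacent to \<open>I\<close>, then
  \<open>insert j I\<close> is again connected, so maximality puts \<open>j\<close> into
  \<open>I\<close>.\<close>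

lemma component_closed_in:
  assumes "I \<in> component_vertex_sets G Z"
  shows "closed_in G Z I" "I \<noteq> {}"
proof -
  have sub: "I \<subseteq> Z" and conn: "Digraph_Component.connected (G \<restriction> I)"
    and max: "\<And>J. I \<subseteq> J \<Longrightarrow> J \<subseteq> Z \<Longrightarrow> Digraph_Component.connected (G \<restriction> J) \<Longrightarrow> J = I"
    using assms by (auto simp: component_vertex_sets_def)
  have min: "\<And>K. closed_in G I K \<Longrightarrow> K \<noteq> {} \<Longrightarrow> K = I" and ne: "I \<noteq> {}"
    using conn by (auto simp: connected_induce_iff)
  show "I \<noteq> {}" by fact
  have "j \<in> I" if i: "i \<in> I" and j: "j \<in> neighbours G i" "j \<in> Z" for i j
  proof -
    \<comment> \<open>\<open>K\<close> meets \<open>I\<close>, since \<open>j\<close> alone would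
      force its neighbour \<open>i\<close> into \<open>K\<close>. Minimality then gives
      \<open>I \<subseteq> K\<close>, and \<open>i\<close> in turn forces \<open>j\<close> into
      \<open>K\<close>.\<close>
    have "K = insert j I" if K: "closed_in G (insert j I) K" "K \<noteq> {}" for K
    proof -
      have "closed_in G I (K \<inter> I)" using K(1) by (auto simp: closed_in_def)
      moreover have "K \<inter> I \<noteq> {}"
        using K i j neighbours_sym[of i j] by (fastforce simp: closed_in_def)
      ultimately have "I \<subseteq> K" using min by blast
      then show ?thesis using K i j by (auto simp: closed_in_def)
    qed
    then have "Digraph_Component.connected (G \<restriction> insert j I)"
      by (auto simp: connected_induce_iff)
    then show ?thesis using max[of "insert j I"] sub j by blast
  qed
  then show "closed_in G Z I" using sub by (auto simp: closed_in_def)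
qed

text \<open>By finiteness \<open>K\<close> contains a minimal nonempty closed set \<open>I\<close>.
  It is connected, as sets closed in \<open>I\<close> are closed in \<open>Z\<close>, and maximal,
  as it is closed in every larger \<open>J \<subseteq> Z\<close>.\<close>

lemma closed_in_contains_component:
  assumes "finite Z" "closed_in G Z K" "K \<noteq> {}"
  obtains I where "I \<in> component_vertex_sets G Z" "I \<subseteq> K"
proof -
  let ?A = "{K'. closed_in G Z K' \<and> K' \<noteq> {} \<and> K' \<subseteq> K}"
  have "finite ?A"
    by (rule finite_subset[of _ "Pow Z"]) (use assms(1) in \<open>auto simp: closed_in_def\<close>)
  moreover have "?A \<noteq> {}" using assms by blast
  ultimately obtain I where "I \<in> ?A" and minA: "\<forall>K'\<in>?A. K' \<subseteq> I \<longrightarrow> I = K'"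
    using finite_has_minimal[of ?A] by blast
  then have I: "closed_in G Z I" "I \<noteq> {}" "I \<subseteq> K" by auto
  have min: "K' = I" if "closed_in G Z K'" "K' \<noteq> {}" "K' \<subseteq> I" for K'
    using minA that I(3) by blast
  have "Digraph_Component.connected (G \<restriction> I)"
    unfolding connected_induce_iff
    using I min closed_in_trans[OF I(1)] by (auto simp: closed_in_def)
  moreover have "J = I"
    if "I \<subseteq> J" "J \<subseteq> Z" "Digraph_Component.connected (G \<restriction> J)" for J
    using that closed_in_restrict[OF I(1)] I(2) by (auto simp: connected_induce_iff)
  ultimately have "I \<in> component_vertex_sets G Z"
    using I(1) by (auto simp: component_vertex_sets_def closed_in_def)
  then show thesis using that I(3) by blast
qed

section \<open>Necessity: closed sets of zeros along asynchronous paths\<close>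

abbreviation reach :: "(nat \<Rightarrow> bool) \<Rightarrow> (nat \<Rightarrow> bool) \<Rightarrow> bool" where
  "reach x y \<equiv> x \<rightarrow>\<^sup>*\<^bsub>async_dynamics L (delta_notch G)\<^esub> y"

interpretation AD: wf_digraph "async_dynamics L (delta_notch G)"
  by (rule wf_async_dynamics)

lemma neighbours_subset: "neighbours G i \<subseteq> {1..L}"
  using verts by (auto simp: neighbours_def dest: in_arcsD2)

lemma delta_notch_iff:
  "i \<in> {1..L} \<Longrightarrow> delta_notch G x i \<longleftrightarrow> neighbours G i \<inter> zeros L x \<noteq> {}"
  using neighbours_subset[of i] by (auto simp: delta_notch_def verts zeros_def subset_iff)

lemma closed_in_zeros_step:
  assumes "i \<in> {1..L}" "delta_notch G x i \<noteq> x i"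
    and K: "closed_in G (zeros L x) K" "K \<noteq> {}"
  shows "\<exists>K'\<subseteq>K. K' \<noteq> {} \<and> closed_in G (zeros L (x(i := \<not> x i))) K'"
proof (cases "x i")
  case True
  then have "neighbours G i \<inter> zeros L x = {}" using assms(1,2) by (simp add: delta_notch_iff)
  moreover have "zeros L (x(i := \<not> x i)) = insert i (zeros L x)"
    using True assms(1) by (auto simp: zeros_def)
  moreover have "i \<notin> neighbours G u" if "u \<in> K" for u
    using that K(1) calculation(1) neighbours_sym[of i u] by (auto simp: closed_in_def)
  ultimately have "closed_in G (zeros L (x(i := \<not> x i))) K"
    using K(1) by (auto simp: closed_in_def)
  then show ?thesis using K(2) by blast
next
  case False
  then obtain j where j: "j \<in> neighbours G i" "j \<in> zeros L x"
    using assms(1,2) by (auto simp: delta_notch_iff)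
  have z: "zeros L (x(i := \<not> x i)) = zeros L x - {i}"
    using False by (auto simp: zeros_def)
  have "closed_in G (zeros L (x(i := \<not> x i))) (K - {i})"
    using K(1) by (auto simp: closed_in_def z)
  \<comment> \<open>If \<open>i\<close> lies in \<open>K\<close>, closedness puts \<open>j\<close>
    into \<open>K\<close> too, and \<open>j\<close> differs from \<open>i\<close> because there are
    no loops.\<close>
  moreover have "K - {i} \<noteq> {}"
    using K j not_in_neighbours_self[of i] by (fastforce simp: closed_in_def)
  ultimately show ?thesis by (intro exI[of _ "K - {i}"]) simp
qed

lemma closed_in_zeros_reach:
  assumes "reach x y" and "closed_in G (zeros L x) K" "K \<noteq> {}"
  shows "\<exists>K'\<subseteq>K. K' \<noteq> {} \<and> closed_in G (zeros L y) K'"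
  using assms(1)
proof (induction rule: AD.reachable_induct)
  case base
  then show ?case using assms by blast
next
  case (step z w)
  then obtain i where "i \<in> {1..L}" "delta_notch G z i \<noteq> z i" "w = z(i := \<not> z i)"
    by (auto simp: async_dynamics_def)
  moreover obtain K' where "K' \<subseteq> K" "K' \<noteq> {}" "closed_in G (zeros L z) K'"
    using step.IH by blast
  ultimately show ?case using closed_in_zeros_step[of i z K'] by blast
qed

section \<open>Sufficiency: raising and lowering vertices\<close>

lemma step_reach:
  assumes "x \<in> states L" "i \<in> {1..L}" "delta_notch G x i \<noteq> x i"
  shows "reach x (x(i := \<not> x i))"
  using assms by (intro AD.reachable_adjI) (auto simp: async_dynamics_def)

lemma raise_reach:
  assumes "S \<subseteq> {1..L}" "i \<in> {1..L}" "i \<notin> S" "neighbours G i \<inter> S \<noteq> {}"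
  shows "reach (state_of_zeros L (insert i S)) (state_of_zeros L S)"
proof -
  let ?x = "state_of_zeros L (insert i S)"
  have "?x(i := \<not> ?x i) = state_of_zeros L S"
    using assms by (auto simp: state_of_zeros_def fun_eq_iff)
  moreover have "delta_notch G ?x i \<noteq> ?x i"
    using assms by (auto simp: delta_notch_iff zeros_state_of_zeros) (auto simp: state_of_zeros_def)
  ultimately show ?thesis
    using step_reach[OF state_of_zeros_in_states, of i "insert i S"] assms(2) by simp
qed

lemma lower_reach:
  assumes "S \<subseteq> {1..L}" "i \<in> {1..L}" "i \<notin> S" "neighbours G i \<inter> S = {}"
  shows "reach (state_of_zeros L S) (state_of_zeros L (insert i S))"
proof -
  let ?x = "state_of_zeros L S"
  have "?x(i := \<not> ?x i) = state_of_zeros L (insert i S)"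
    using assms by (auto simp: state_of_zeros_def fun_eq_iff)
  moreover have "delta_notch G ?x i \<noteq> ?x i"
    using assms by (auto simp: delta_notch_iff zeros_state_of_zeros) (auto simp: state_of_zeros_def)
  ultimately show ?thesis
    using step_reach[OF state_of_zeros_in_states, of i S] assms(2) by simp
qed

text \<open>The path is built backwards from \<open>w\<close>: each step of the induction prepends
  the raising of one vertex, so that \<open>S\<close> grows until it equals
  \<open>Z\<close>.\<close>

lemma raise_outside_reach:
  assumes "Z \<subseteq> {1..L}" "A \<subseteq> S" "S \<subseteq> Z"
    and meets: "\<And>K. closed_in G Z K \<Longrightarrow> K \<noteq> {} \<Longrightarrow> K \<inter> A \<noteq> {}"
    and "reach (state_of_zeros L S) w"
  shows "reach (state_of_zeros L Z) w"
  using assms(2,3,5)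
proof (induction "card (Z - S)" arbitrary: S rule: less_induct)
  case less
  have fin: "finite Z" using assms(1) finite_subset by blast
  show ?case
  proof (cases "S = Z")
    case True
    then show ?thesis using less.prems by simp
  next
    case False
    \<comment> \<open>\<open>Z - S\<close> is nonempty and misses \<open>A\<close>, so some vertex
      of it has a neighbour in \<open>S\<close> and can be the next one raised.\<close>
    then have "\<not> closed_in G Z (Z - S)" using meets less.prems by blast
    then obtain u i where u: "u \<in> Z - S" and i: "i \<in> S" "i \<in> neighbours G u"
      by (auto simp: closed_in_def)
    have "reach (state_of_zeros L (insert u S)) (state_of_zeros L S)"
      using u i assms(1) less.prems by (intro raise_reach) auto
    then have "reach (state_of_zeros L (insert u S)) w"
      using less.prems(3) AD.reachable_trans by blast
    moreover have "card (Z - insert u S) < card (Z - S)"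
      using u fin by (intro psubset_card_mono) auto
    ultimately show ?thesis using less.hyps[of "insert u S"] less.prems u by blast
  qed
qed

text \<open>Every intermediate set of zeros stays inside the independent set \<open>Y\<close>, so a
  missing vertex of \<open>Y\<close> never has a zero neighbour and can always be lowered.\<close>

lemma lower_independent_reach:
  assumes "Y \<subseteq> {1..L}" "S \<subseteq> Y" and indep: "\<And>i. i \<in> Y \<Longrightarrow> neighbours G i \<inter> Y = {}"
  shows "reach (state_of_zeros L S) (state_of_zeros L Y)"
  using assms(2)
proof (induction "card (Y - S)" arbitrary: S rule: less_induct)
  case less
  have fin: "finite Y" using assms(1) finite_subset by blast
  show ?case
  proof (cases "S = Y")
    case True
    then show ?thesis
      using AD.reachable_refl state_of_zeros_in_states by (simp add: async_dynamics_def)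
  next
    case False
    then obtain i where i: "i \<in> Y" "i \<notin> S" using less.prems by blast
    have "reach (state_of_zeros L S) (state_of_zeros L (insert i S))"
      using i indep[of i] assms(1) less.prems by (intro lower_reach) auto
    moreover have "card (Y - insert i S) < card (Y - S)"
      using i fin by (intro psubset_card_mono) auto
    ultimately show ?thesis
      using less.hyps[of "insert i S"] less.prems i AD.reachable_trans by blast
  qed
qed

lemma fixed_point_zeros_independent:
  assumes "delta_notch G y = y" "i \<in> zeros L y"
  shows "neighbours G i \<inter> zeros L y = {}"
proof -
  have "i \<in> {1..L}" "\<not> delta_notch G y i" using assms by (auto simp: zeros_def)
  then show ?thesis by (simp add: delta_notch_iff)
qed

theorem fixed_point_reach_iff:
  assumes x: "x \<in> states L" and y: "y \<in> states L" and fixed: "delta_notch G y = y"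
  shows "reach x y \<longleftrightarrow> (\<forall>I \<in> component_vertex_sets G (zeros L x). I \<inter> zeros L y \<noteq> {})"
proof (intro iffI ballI)
  fix I
  assume "reach x y" "I \<in> component_vertex_sets G (zeros L x)"
  then obtain K where "K \<subseteq> I" "K \<noteq> {}" "closed_in G (zeros L y) K"
    using closed_in_zeros_reach component_closed_in by meson
  then show "I \<inter> zeros L y \<noteq> {}" by (auto simp: closed_in_def)
next
  assume meets: "\<forall>I \<in> component_vertex_sets G (zeros L x). I \<inter> zeros L y \<noteq> {}"
  \<comment> \<open>The state with zeros \<open>?A\<close> is the turning point of the path: up to
    it vertices are only raised, after it only lowered.\<close>
  let ?A = "zeros L x \<inter> zeros L y"
  have "K \<inter> ?A \<noteq> {}" if K: "closed_in G (zeros L x) K" "K \<noteq> {}" for K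
  proof -
    obtain I where "I \<in> component_vertex_sets G (zeros L x)" "I \<subseteq> K"
      using closed_in_contains_component[OF finite_zeros K] .
    then show ?thesis using meets K(1) by (fastforce simp: closed_in_def)
  qed
  moreover have "reach (state_of_zeros L ?A) (state_of_zeros L (zeros L y))"
    by (intro lower_independent_reach fixed_point_zeros_independent[OF fixed])
      (auto simp: zeros_def)
  ultimately have "reach (state_of_zeros L (zeros L x)) (state_of_zeros L (zeros L y))"
    by (intro raise_outside_reach[of "zeros L x" ?A ?A]) (auto simp: zeros_def)
  then show "reach x y" by (simp add: state_of_zeros_zeros x y)
qed

end

theorem theorem9:
  fixes L :: nat and G :: "nat pair_pre_digraph" and x y :: "nat \<Rightarrow> bool"
  assumes "L \<ge> 1"
    and "pair_graph G"
    and "pverts G = {1..L}"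
    and "Digraph_Component.connected G"
    and "x \<in> states L"
    and "y \<in> states L"
    and "delta_notch G y = y"
  shows "x \<rightarrow>\<^sup>*\<^bsub>async_dynamics L (delta_notch G)\<^esub> y \<longleftrightarrow>
    (\<forall>I \<in> component_vertex_sets G {i \<in> {1..L}. \<not> x i}. \<exists>i\<in>I. \<not> y i)"
proof -
  interpret pair_graph G by fact
  interpret delta_notch_graph G L by unfold_locales fact
  \<comment> \<open>Components lie inside \<open>{1..L}\<close>, so for their vertices
    \<open>\<not> y i\<close> already means membership in \<open>zeros L y\<close>.\<close>
  have "I \<inter> zeros L y \<noteq> {} \<longleftrightarrow> (\<exists>i\<in>I. \<not> y i)"
    if "I \<in> component_vertex_sets G (zeros L x)" for I
    using that by (auto simp: component_vertex_sets_def zeros_def)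
  then show ?thesis
    using fixed_point_reach_iff[OF assms(5-7)] by (simp add: zeros_def)
qed

end
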